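(* The joint spatial channel selection and mobility game $\Upsilon$, in which each user $n\in\mathcal{N}$ chooses a location and channel pair $(d_n,a_n)\in\Delta_n\times\mathcal{M}$ and has payoff $U_n(\boldsymbol{d},\boldsymbol{a})$, is a weighted potential game with potential function $$\Phi(\boldsymbol{d},\boldsymbol{a})=\sum_{i=1}^{N}-\log(1-p_{i})\left(\frac{1}{2}\sum_{j\in\mathcal{N}_{i}^{a_{i}}(\boldsymbol{d},\boldsymbol{a})}\log(1-p_{j})+\log\left(\theta_{a_{i}}B_{a_{i},d_{i}}^{i}p_{i}\right)\right)$$ and weights $w_n=-\log(1-p_n)$. That is, for every $n\in\mathcal{N}$ and any two profiles $(\boldsymbol{d},\boldsymbol{a})$, $(\boldsymbol{d}',\boldsymbol{a}')$ that differ only in the location and/or channel of user $n$, $$\Phi(\boldsymbol{d}',\boldsymbol{a}')-\Phi(\boldsymbol{d},\boldsymbol{a})=w_n\left(U_n(\boldsymbol{d}',\boldsymbol{a}')-U_n(\boldsymbol{d},\boldsymbol{a})\right),\qquad w_n>0.$$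
   Context: Users $\mathcal{N}=\{1,\dots,N\}$; channels $\mathcal{M}=\{1,\dots,M\}$; $\Delta$ is a finite set of locations with a distance $\|\cdot,\cdot\|$; $\Delta_n\subseteq\Delta$ is the location selection space of user $n$; $\delta$ is the transmission range. For $\boldsymbol{d}=(d_1,\dots,d_N)\in\Delta_1\times\dots\times\Delta_N$, $\mathcal{N}_n(\boldsymbol{d})=\{i\in\mathcal{N}:i\ne n,\ \|d_i,d_n\|\le\delta\}$. Parameters: $\theta_m\in(0,1)$; mean data rates $B_{m,d}^n>0$ of user $n$ on channel $m$ at location $d$; fixed contention probabilities $p_n\in(p_{\min},p_{\max})$ with $0<p_{\min}<p_{\max}<1$. For $\boldsymbol{a}\in\mathcal{M}^N$, $\mathcal{N}_n^{a_n}(\boldsymbol{d},\boldsymbol{a})=\{i\in\mathcal{N}_n(\boldsymbol{d}):a_i=a_n\}$, and $$U_n(\boldsymbol{d},\boldsymbol{a})=\log\Big(\theta_{a_n}B_{a_n,d_n}^n p_n\prod_{i\in\mathcal{N}_n^{a_n}(\boldsymbol{d},\boldsymbol{a})}(1-p_i)\Big).$$ *)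

theory Defs
  imports "HOL-Analysis.Abstract_Metric_Spaces" "HOL-Library.FuncSet"
begin

text \<open>
  A strategic game is given by its player set \<open>I\<close>, strategy sets \<open>S i\<close> and payoffs
  \<open>u i s\<close>, where a strategy profile is an extensional function \<open>s \<in> Pi\<^sub>E I S\<close>.
\<close>

definition weighted_potential_game ::
  "'i set \<Rightarrow> ('i \<Rightarrow> 's set) \<Rightarrow> ('i \<Rightarrow> ('i \<Rightarrow> 's) \<Rightarrow> real) \<Rightarrow> (('i \<Rightarrow> 's) \<Rightarrow> real) \<Rightarrow> ('i \<Rightarrow> real) \<Rightarrow> bool"
  where
  "weighted_potential_game I S u \<Phi> w \<longleftrightarrow>
     (\<forall>n\<in>I. w n > 0 \<and>
       (\<forall>s\<in>Pi\<^sub>E I S. \<forall>s'\<in>Pi\<^sub>E I S. (\<forall>i\<in>I - {n}. s' i = s i) \<longrightarrow>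
          \<Phi> s' - \<Phi> s = w n * (u n s' - u n s)))"

text \<open>
  Users are \<open>{1..N}\<close>. In the following, \<open>d i\<close> and \<open>a i\<close> are the location and channel of user
  \<open>i\<close>, \<open>dst\<close> is the distance between locations, \<open>\<delta>\<close> the transmission range, \<open>p i\<close> the
  contention probability of user \<open>i\<close>, and \<open>B i m l\<close> the mean data rate of user \<open>i\<close> on
  channel \<open>m\<close> at location \<open>l\<close>.
\<close>

definition neighbours :: "nat \<Rightarrow> ('l \<Rightarrow> 'l \<Rightarrow> real) \<Rightarrow> real \<Rightarrow> (nat \<Rightarrow> 'l) \<Rightarrow> nat \<Rightarrow> nat set" where
  "neighbours N dst \<delta> d n = {i \<in> {1..N}. i \<noteq> n \<and> dst (d i) (d n) \<le> \<delta>}"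

definition cochannel_neighbours ::
  "nat \<Rightarrow> ('l \<Rightarrow> 'l \<Rightarrow> real) \<Rightarrow> real \<Rightarrow> (nat \<Rightarrow> 'l) \<Rightarrow> (nat \<Rightarrow> nat) \<Rightarrow> nat \<Rightarrow> nat set" where
  "cochannel_neighbours N dst \<delta> d a n = {i \<in> neighbours N dst \<delta> d n. a i = a n}"

definition payoff ::
  "nat \<Rightarrow> ('l \<Rightarrow> 'l \<Rightarrow> real) \<Rightarrow> real \<Rightarrow> (nat \<Rightarrow> real) \<Rightarrow> (nat \<Rightarrow> nat \<Rightarrow> 'l \<Rightarrow> real) \<Rightarrow> (nat \<Rightarrow> real) \<Rightarrow>
   nat \<Rightarrow> (nat \<Rightarrow> 'l) \<Rightarrow> (nat \<Rightarrow> nat) \<Rightarrow> real" where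
  "payoff N dst \<delta> \<theta> B p n d a =
     ln (\<theta> (a n) * B n (a n) (d n) * p n *
         (\<Prod>i\<in>cochannel_neighbours N dst \<delta> d a n. 1 - p i))"

definition potential ::
  "nat \<Rightarrow> ('l \<Rightarrow> 'l \<Rightarrow> real) \<Rightarrow> real \<Rightarrow> (nat \<Rightarrow> real) \<Rightarrow> (nat \<Rightarrow> nat \<Rightarrow> 'l \<Rightarrow> real) \<Rightarrow> (nat \<Rightarrow> real) \<Rightarrow>
   (nat \<Rightarrow> 'l) \<Rightarrow> (nat \<Rightarrow> nat) \<Rightarrow> real" where
  "potential N dst \<delta> \<theta> B p d a =
     (\<Sum>i = 1..N. - ln (1 - p i) *
        (1 / 2 * (\<Sum>j\<in>cochannel_neighbours N dst \<delta> d a i. ln (1 - p j))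
         + ln (\<theta> (a i) * B i (a i) (d i) * p i)))"

end

theory Submission
  imports Defs
begin

text \<open>
  The terms of \<open>\<Phi>\<close> that mention user \<open>n\<close> are its own summand and the pair terms
  \<open>1/2 * ln (1 - p i) * ln (1 - p n)\<close> in the summands of its neighbours \<open>i\<close>. Since being a
  co-channel neighbour is symmetric, each pair occurs twice with factor \<open>1/2\<close>, so together
  these terms are exactly \<open>w n * U n\<close>; the remaining terms do not depend on the choice of \<open>n\<close>.
\<close>

lemma sum_pair_potential_split:
  fixes x g :: "'i \<Rightarrow> real"
  assumes "finite I" "n \<in> I" "\<And>i j. r i j = r j i" "\<not> r n n"
  shows "(\<Sum>i\<in>I. - x i * (1 / 2 * (\<Sum>j | j \<in> I \<and> r i j. x j) + g i)) =
         - x n * ((\<Sum>j | j \<in> I \<and> r n j. x j) + g n) +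
         (\<Sum>i\<in>I - {n}. - x i * (1 / 2 * (\<Sum>j | j \<in> I - {n} \<and> r i j. x j) + g i))"
proof -
  \<comment> \<open>Encoding \<open>r\<close> as a 0-or-\<open>x j\<close> weight moves the
    condition from the index set into the summand, so that index \<open>n\<close> can be split off
    with \<open>sum.remove\<close>.\<close>
  define e :: "'i \<Rightarrow> 'i \<Rightarrow> real" where "e i j = (if r i j then x j else 0)" for i j
  have e: "(\<Sum>j | j \<in> J \<and> r i j. x j) = (\<Sum>j\<in>J. e i j)" if "J \<subseteq> I" for i J
    unfolding e_def using sum.inter_filter[of J x "r i"] finite_subset[OF that assms(1)] by simp
  \<comment> \<open>Both sides are \<open>x i * x n\<close> if the pair is related and 0 otherwise;
    this is the only use of the symmetry of \<open>r\<close>.\<close>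
  have sym: "x i * e i n = x n * e n i" for i
    using assms(3)[of i n] by (simp add: e_def)
  have split: "(\<Sum>j\<in>I. f j) = f n + (\<Sum>j\<in>I - {n}. f j)" for f :: "'i \<Rightarrow> real"
    using assms(1,2) by (rule sum.remove)
  have "e n n = 0"
    using assms(4) by (simp add: e_def)
  then have "(\<Sum>i\<in>I. - x i * (1 / 2 * (\<Sum>j\<in>I. e i j) + g i)) =
      - x n * (1 / 2 * (\<Sum>j\<in>I - {n}. e n j) + g n) +
      (\<Sum>i\<in>I - {n}. - x i * (1 / 2 * (e i n + (\<Sum>j\<in>I - {n}. e i j)) + g i))"
    by (simp add: split)
  also have "(\<Sum>i\<in>I - {n}. - x i * (1 / 2 * (e i n + (\<Sum>j\<in>I - {n}. e i j)) + g i)) =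
      (\<Sum>i\<in>I - {n}. - (1 / 2) * (x i * e i n) - x i * (1 / 2 * (\<Sum>j\<in>I - {n}. e i j) + g i))"
    by (rule sum.cong) (simp_all add: algebra_simps)
  \<comment> \<open>By \<open>sym\<close>, the halves collected from the other summands equal the
    half in the summand of \<open>n\<close>; together they make the inner sum of \<open>n\<close>
    appear with factor 1.\<close>
  also have "\<dots> = - (1 / 2) * x n * (\<Sum>i\<in>I - {n}. e n i) +
      (\<Sum>i\<in>I - {n}. - x i * (1 / 2 * (\<Sum>j\<in>I - {n}. e i j) + g i))"
    by (simp add: sym sum_subtractf sum_negf sum_distrib_left mult.assoc)
  finally show ?thesis
    using \<open>e n n = 0\<close> e[of I] e[of "I - {n}"] split[of "e n"]
    by (simp add: algebra_simps)
qed

text \<open>All factors under the logarithm are positive, so it splits. The additive form is what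
  can be compared with the summand of \<open>n\<close> in the potential.\<close>

lemma payoff_eq_sum_ln:
  assumes "\<theta> (a n) > 0" "B n (a n) (d n) > 0" "p n > 0" "\<And>i. i \<in> {1..N} \<Longrightarrow> p i < 1"
  shows "payoff N dst \<delta> \<theta> B p n d a =
         (\<Sum>i\<in>cochannel_neighbours N dst \<delta> d a n. ln (1 - p i)) + ln (\<theta> (a n) * B n (a n) (d n) * p n)"
proof -
  let ?C = "cochannel_neighbours N dst \<delta> d a n"
  have sub: "?C \<subseteq> {1..N}"
    by (auto simp: cochannel_neighbours_def neighbours_def)
  then have pos: "1 - p i > 0" if "i \<in> ?C" for i
    using assms(4)[of i] that by (simp add: subset_iff)
  have "ln (\<Prod>i\<in>?C. 1 - p i) = (\<Sum>i\<in>?C. ln (1 - p i))"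
    using pos finite_subset[OF sub] by (intro ln_prod) force+
  moreover have "(\<Prod>i\<in>?C. 1 - p i) > 0"
    using pos by (rule prod_pos)
  ultimately show ?thesis
    unfolding payoff_def using assms(1-3) by (subst ln_mult_pos) simp_all
qed

theorem lemma7:
  fixes N M :: nat
    and \<Delta> :: "'l set" and dst :: "'l \<Rightarrow> 'l \<Rightarrow> real"
    and \<Delta>sel :: "nat \<Rightarrow> 'l set"
    and \<delta> p_min p_max :: real
    and \<theta> p :: "nat \<Rightarrow> real"
    and B :: "nat \<Rightarrow> nat \<Rightarrow> 'l \<Rightarrow> real"
  assumes "finite \<Delta>" and "Metric_space \<Delta> dst"
    and "\<And>n. n \<in> {1..N} \<Longrightarrow> \<Delta>sel n \<subseteq> \<Delta>"
    and "\<And>m. m \<in> {1..M} \<Longrightarrow> 0 < \<theta> m \<and> \<theta> m < 1"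
    and "\<And>n m l. n \<in> {1..N} \<Longrightarrow> m \<in> {1..M} \<Longrightarrow> l \<in> \<Delta> \<Longrightarrow> B n m l > 0"
    and "0 < p_min" and "p_min < p_max" and "p_max < 1"
    and "\<And>n. n \<in> {1..N} \<Longrightarrow> p_min < p n \<and> p n < p_max"
  shows "weighted_potential_game {1..N} (\<lambda>n. \<Delta>sel n \<times> {1..M})
           (\<lambda>n s. payoff N dst \<delta> \<theta> B p n (fst \<circ> s) (snd \<circ> s))
           (\<lambda>s. potential N dst \<delta> \<theta> B p (fst \<circ> s) (snd \<circ> s))
           (\<lambda>n. - ln (1 - p n))"
proof -
  define r where "r s i j \<longleftrightarrow> j \<noteq> i \<and> dst (fst (s j)) (fst (s i)) \<le> \<delta> \<and> snd (s j) = snd (s i)"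
    for s :: "nat \<Rightarrow> 'l \<times> nat" and i j
  define x where "x i = ln (1 - p i)" for i
  define g where "g s i = ln (\<theta> (snd (s i)) * B i (snd (s i)) (fst (s i)) * p i)"
    for s :: "nat \<Rightarrow> 'l \<times> nat" and i
  \<comment> \<open>This is the potential of the game with user \<open>n\<close> removed.\<close>
  define R where "R n s = (\<Sum>i\<in>{1..N} - {n}.
      - x i * (1 / 2 * (\<Sum>j | j \<in> {1..N} - {n} \<and> r s i j. x j) + g s i))" for n s
  have p: "0 < p i" "p i < 1" if "i \<in> {1..N}" for i
    using assms(6-8) assms(9)[OF that] by linarith+
  have C: "cochannel_neighbours N dst \<delta> (fst \<circ> s) (snd \<circ> s) i = {j. j \<in> {1..N} \<and> r s i j}" for s i
    by (auto simp: cochannel_neighbours_def neighbours_def r_def)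
  \<comment> \<open>Symmetry of a \<open>Metric_space\<close> distance holds for all arguments, so
    \<open>s\<close> may be arbitrary here.\<close>
  have r_sym: "r s i j = r s j i" for s i j
    using Metric_space.commute[OF assms(2), of "fst (s i)" "fst (s j)"] by (auto simp: r_def)
  have payoff: "payoff N dst \<delta> \<theta> B p n (fst \<circ> s) (snd \<circ> s) =
      (\<Sum>j | j \<in> {1..N} \<and> r s n j. x j) + g s n"
    if "n \<in> {1..N}" "s \<in> (\<Pi>\<^sub>E i\<in>{1..N}. \<Delta>sel i \<times> {1..M})" for n s
  proof -
    \<comment> \<open>Being a profile places user \<open>n\<close> where \<theta> and
      \<open>B\<close> are known to be positive.\<close>
    have "s n \<in> \<Delta>sel n \<times> {1..M}"
      using that by (blast dest: PiE_mem)
    then have "fst (s n) \<in> \<Delta>" "snd (s n) \<in> {1..M}"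
      using assms(3)[OF that(1)] by auto
    then have "payoff N dst \<delta> \<theta> B p n (fst \<circ> s) (snd \<circ> s) =
        (\<Sum>i\<in>cochannel_neighbours N dst \<delta> (fst \<circ> s) (snd \<circ> s) n. ln (1 - p i)) +
        ln (\<theta> ((snd \<circ> s) n) * B n ((snd \<circ> s) n) ((fst \<circ> s) n) * p n)"
      using assms(4,5) p that(1) by (intro payoff_eq_sum_ln) simp_all
    then show ?thesis
      by (simp add: C x_def g_def)
  qed
  have potential: "potential N dst \<delta> \<theta> B p (fst \<circ> s) (snd \<circ> s) =
      - x n * ((\<Sum>j | j \<in> {1..N} \<and> r s n j. x j) + g s n) + R n s" if "n \<in> {1..N}" for n s
  proof -
    have "\<not> r s n n"
      by (simp add: r_def)
    with sum_pair_potential_split[of "{1..N}" n "r s" x "g s"] that r_sym[of s] show ?thesis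
      unfolding potential_def C R_def x_def[symmetric] by (simp add: g_def)
  qed
  have R: "R n s' = R n s" if "\<forall>i\<in>{1..N} - {n}. s' i = s i" for n s s'
  proof -
    \<comment> \<open>Both \<open>i\<close> and \<open>j\<close> differ from \<open>n\<close>, so
      \<open>r\<close> only compares entries on which the two profiles agree.\<close>
    have "{j. j \<in> {1..N} - {n} \<and> r s' i j} = {j. j \<in> {1..N} - {n} \<and> r s i j}"
      if "i \<in> {1..N} - {n}" for i
      using that \<open>\<forall>i\<in>{1..N} - {n}. s' i = s i\<close> by (intro Collect_cong) (auto simp: r_def)
    moreover have "g s' i = g s i" if "i \<in> {1..N} - {n}" for i
      using that \<open>\<forall>i\<in>{1..N} - {n}. s' i = s i\<close> by (simp add: g_def)
    ultimately show ?thesis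
      unfolding R_def by (intro sum.cong) simp_all
  qed
  show ?thesis
    unfolding weighted_potential_game_def
  proof (intro ballI conjI impI)
    fix n assume "n \<in> {1..N}"
    then show "0 < - ln (1 - p n)"
      using p[of n] by simp
  next
    fix n s s'
    assume n: "n \<in> {1..N}"
      and s: "s \<in> (\<Pi>\<^sub>E i\<in>{1..N}. \<Delta>sel i \<times> {1..M})" "s' \<in> (\<Pi>\<^sub>E i\<in>{1..N}. \<Delta>sel i \<times> {1..M})"
      and eq: "\<forall>i\<in>{1..N} - {n}. s' i = s i"
    show "potential N dst \<delta> \<theta> B p (fst \<circ> s') (snd \<circ> s') - potential N dst \<delta> \<theta> B p (fst \<circ> s) (snd \<circ> s) =
        - ln (1 - p n) * (payoff N dst \<delta> \<theta> B p n (fst \<circ> s') (snd \<circ> s') -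
          payoff N dst \<delta> \<theta> B p n (fst \<circ> s) (snd \<circ> s))"
      \<comment> \<open>Each potential becomes \<open>- x n\<close> times the payoff of
        \<open>n\<close> plus the same \<open>R n s\<close>, which cancels in the
        difference.\<close>
      unfolding payoff[OF n s(1)] payoff[OF n s(2)] potential[OF n] R[OF eq] x_def[symmetric]
      by (simp add: algebra_simps)
  qed
qed

end
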